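(* Let $p$ and $q=1-p$ be probabilities (so $p,q\ge 0$ and $p+q=1$). The maps $T_i:\mathcal H\to\mathcal H$ ($1\le i\le N-1$) defined by $T_i(\sigma,h)=(T_i\sigma,\,T_i^0(\sigma,h))$ satisfy (i) $T_i\,T_i=I$; (ii) $T_i\,T_j=T_j\,T_i$ when $|i-j|>1$; (iii) $T_i\,T_{i+1}\,T_i=T_{i+1}\,T_i\,T_{i+1}$.
   Context: $N$ and $M$ are positive integers. $\mathcal S_N$ is the permutation group of $\{1,\dots,N\}$. For $\sigma\in\mathcal S_N$, $T_i\sigma$ is $\sigma$ with the entries $\sigma(i)$ and $\sigma(i+1)$ interchanged. For a function $\pi:\{1,\dots,N\}\to\{1,\dots,M\}$ (with $\pi_i=\pi(i)$), $T_i\pi$ is $\pi$ with the entries $\pi_i$ and $\pi_{i+1}$ interchanged. The same symbol $T_i$ is used for these operations and for the maps on $\mathcal H$; relations (i)–(iii) in the claim concern the maps on $\mathcal H$. $\mathcal H_0$ is the set of all functions $h:\pi\to$ function of $\xi$, that is, all $h$ assigning to each $\pi:\{1,\dots,N\}\to\{1,\dots,M\}$ a function $h(\pi)$ of $\xi=(\xi_1,\dots,\xi_N)$, where the $\xi_i$ are complex variables; and $\mathcal H=\mathcal S_N\times\mathcal H_0$. Put $$S(\xi,\xi')=-\frac{p+q\xi\xi'-\xi}{p+q\xi\xi'-\xi'},$$ $$\alpha_i(\pi)=\begin{cases}0&\text{if }\pi_i=\pi_{i+1}\\ p&\text{if }\pi_i<\pi_{i+1}\\ q&\text{if }\pi_i>\pi_{i+1}\end{cases},\qquad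 \beta_i(\pi)=\begin{cases}0&\text{if }\pi_i=\pi_{i+1}\\ q&\text{if }\pi_i<\pi_{i+1}\\ p&\text{if }\pi_i>\pi_{i+1}.\end{cases}$$ The map $T_i^0:\mathcal H\to\mathcal H_0$ is $$T_i^0(\sigma,h)=h+\bigl(1+S(\xi_{\sigma(i)},\xi_{\sigma(i+1)})\bigr)\bigl[\alpha_i\cdot(h\circ T_i)-\beta_i\cdot h\bigr],$$ where $(h\circ T_i)(\pi)=h(T_i\pi)$ and the products are pointwise in $\pi$. $I$ is the identity map of $\mathcal H$. *)

theory Defs
  imports Complex_Main "HOL-Library.FuncSet" "HOL-Combinatorics.Permutations"
begin

definition S_denom :: "real \<Rightarrow> real \<Rightarrow> complex \<Rightarrow> complex \<Rightarrow> complex" where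
  "S_denom p q x y = of_real p + of_real q * x * y - y"

definition S :: "real \<Rightarrow> real \<Rightarrow> complex \<Rightarrow> complex \<Rightarrow> complex" where
  "S p q x y = - ((of_real p + of_real q * x * y - x) / S_denom p q x y)"

text \<open>The points \<open>\<xi> = (\<xi>\<^sub>1, \<dots>, \<xi>\<^sub>N)\<close> at which every \<open>S(\<xi>\<^sub>i, \<xi>\<^sub>j)\<close> with \<open>i \<noteq> j\<close> is defined.
  A function of \<open>\<xi>\<close> is understood as a function on this domain; elsewhere some factor
  \<open>1 + S(\<xi>\<^sub>\<sigma>\<^sub>(\<^sub>i\<^sub>), \<xi>\<^sub>\<sigma>\<^sub>(\<^sub>i\<^sub>+\<^sub>1\<^sub>))\<close> has no value in the sense of the paper, while HOL division
  would silently return 0.\<close>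

definition xi_domain :: "real \<Rightarrow> real \<Rightarrow> nat \<Rightarrow> (nat \<Rightarrow> complex) set" where
  "xi_domain p q N = {\<xi> \<in> {1..N} \<rightarrow>\<^sub>E UNIV.
     \<forall>i\<in>{1..N}. \<forall>j\<in>{1..N}. i \<noteq> j \<longrightarrow> S_denom p q (\<xi> i) (\<xi> j) \<noteq> 0}"

definition configs :: "nat \<Rightarrow> nat \<Rightarrow> (nat \<Rightarrow> nat) set" where
  "configs N M = {1..N} \<rightarrow>\<^sub>E {1..M}"

type_synonym H0_elem = "(nat \<Rightarrow> nat) \<Rightarrow> (nat \<Rightarrow> complex) \<Rightarrow> complex"

definition H0 :: "real \<Rightarrow> real \<Rightarrow> nat \<Rightarrow> nat \<Rightarrow> H0_elem set" where
  "H0 p q N M = configs N M \<rightarrow>\<^sub>E (xi_domain p q N \<rightarrow>\<^sub>E UNIV)"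

definition H :: "real \<Rightarrow> real \<Rightarrow> nat \<Rightarrow> nat \<Rightarrow> ((nat \<Rightarrow> nat) \<times> H0_elem) set" where
  "H p q N M = {\<sigma>. \<sigma> permutes {1..N}} \<times> H0 p q N M"

text \<open>The entries at positions \<open>i\<close> and \<open>i + 1\<close> are interchanged, both for permutations
  and for configurations \<open>\<pi>\<close>.\<close>

definition swap_entries :: "nat \<Rightarrow> (nat \<Rightarrow> 'a) \<Rightarrow> nat \<Rightarrow> 'a" where
  "swap_entries i f = f \<circ> transpose i (i + 1)"

definition alpha :: "real \<Rightarrow> real \<Rightarrow> nat \<Rightarrow> (nat \<Rightarrow> nat) \<Rightarrow> real" where
  "alpha p q i \<pi> = (if \<pi> i = \<pi> (i + 1) then 0 else if \<pi> i < \<pi> (i + 1) then p else q)"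

definition beta :: "real \<Rightarrow> real \<Rightarrow> nat \<Rightarrow> (nat \<Rightarrow> nat) \<Rightarrow> real" where
  "beta p q i \<pi> = (if \<pi> i = \<pi> (i + 1) then 0 else if \<pi> i < \<pi> (i + 1) then q else p)"

definition T0 :: "real \<Rightarrow> real \<Rightarrow> nat \<Rightarrow> nat \<Rightarrow> nat \<Rightarrow> (nat \<Rightarrow> nat) \<times> H0_elem \<Rightarrow> H0_elem" where
  "T0 p q N M i = (\<lambda>(\<sigma>, h). \<lambda>\<pi>\<in>configs N M. \<lambda>\<xi>\<in>xi_domain p q N.
     h \<pi> \<xi> + (1 + S p q (\<xi> (\<sigma> i)) (\<xi> (\<sigma> (i + 1)))) *
       (of_real (alpha p q i \<pi>) * h (swap_entries i \<pi>) \<xi> - of_real (beta p q i \<pi>) * h \<pi> \<xi>))"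

definition T :: "real \<Rightarrow> real \<Rightarrow> nat \<Rightarrow> nat \<Rightarrow> nat \<Rightarrow>
    (nat \<Rightarrow> nat) \<times> H0_elem \<Rightarrow> (nat \<Rightarrow> nat) \<times> H0_elem" where
  "T p q N M i = (\<lambda>(\<sigma>, h). (swap_entries i \<sigma>, T0 p q N M i (\<sigma>, h)))"

end

(* At a fixed point \<xi>, the map T_i acts on h as the operator 1 + u A_i, where A_i is the Hecke-type
   operator A_i g = \<alpha>_i (g \<circ> T_i) - \<beta>_i g and u = 1 + S(x, y) = (x - y) / (p + q x y - y).
   The operators satisfy A_i A_i = -A_i, A_i A_j = A_j A_i for |i - j| > 1, and
   A_i A_{i+1} A_i - p q A_i = A_{i+1} A_i A_{i+1} - p q A_{i+1}. With these, (i) reduces to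
   u(x,y) + u(y,x) = u(x,y) u(y,x) and (iii) to a + c - a c + p q a b c = b for
   a = u(x,y), b = u(x,z), c = u(y,z). *)
theory Submission
  imports Defs
begin

text \<open>The point \<xi> is frozen, so \<open>g\<close> depends on the configuration alone. It is
  not restricted to \<open>configs\<close>, which frees the operator identities from side conditions
  on \<open>i\<close> and \<open>\<pi>\<close>.\<close>

definition hecke_op ::
    "real \<Rightarrow> real \<Rightarrow> nat \<Rightarrow> ((nat \<Rightarrow> nat) \<Rightarrow> complex) \<Rightarrow> (nat \<Rightarrow> nat) \<Rightarrow> complex" where
  "hecke_op p q i g \<pi> =
     of_real (alpha p q i \<pi>) * g (swap_entries i \<pi>) - of_real (beta p q i \<pi>) * g \<pi>"

definition R_op ::
    "real \<Rightarrow> real \<Rightarrow> nat \<Rightarrow> complex \<Rightarrow> ((nat \<Rightarrow> nat) \<Rightarrow> complex) \<Rightarrow> (nat \<Rightarrow> nat) \<Rightarrow> complex" where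
  "R_op p q i u g \<pi> = g \<pi> + u * hecke_op p q i g \<pi>"

section \<open>Interchanges of adjacent entries\<close>

lemma swap_entries_swap_entries [simp]: "swap_entries i (swap_entries i f) = f"
  by (simp add: swap_entries_def comp_assoc)

lemma swap_entries_apply:
  "swap_entries i f k = (if k = i then f (i + 1) else if k = i + 1 then f i else f k)"
  by (simp add: swap_entries_def transpose_def)

lemma swap_entries_commute:
  assumes "\<bar>int i - int j\<bar> > 1"
  shows "swap_entries i (swap_entries j f) = swap_entries j (swap_entries i f)"
  using assms by (auto simp: fun_eq_iff swap_entries_apply)

lemma swap_entries_braid:
  "swap_entries i (swap_entries (i + 1) (swap_entries i f))
     = swap_entries (i + 1) (swap_entries i (swap_entries (i + 1) f))"
  by (auto simp: fun_eq_iff swap_entries_apply)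

lemma swap_entries_configs:
  assumes "i \<in> {1..N-1}" "\<pi> \<in> configs N M"
  shows "swap_entries i \<pi> \<in> configs N M"
  using assms unfolding configs_def
  by (auto simp: PiE_iff extensional_def swap_entries_apply)

lemma swap_entries_permutes:
  assumes "i \<in> {1..N-1}" "\<sigma> permutes {1..N}"
  shows "swap_entries i \<sigma> permutes {1..N}"
proof -
  have "transpose i (i + 1) permutes {1..N}"
    using assms(1) by (intro permutes_swap_id) auto
  then show ?thesis
    unfolding swap_entries_def using assms(2) by (rule permutes_compose)
qed

section \<open>Hecke relations for the operators A_i\<close>

lemma hecke_op_R_op:
  "hecke_op p q i (R_op p q j u g) \<pi>
     = hecke_op p q i g \<pi> + u * hecke_op p q i (hecke_op p q j g) \<pi>"
  by (simp add: hecke_op_def[of p q i] R_op_def algebra_simps)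

lemma hecke_op_linear:
  "hecke_op p q i (\<lambda>\<pi>. g \<pi> + u * k \<pi>) \<pi> = hecke_op p q i g \<pi> + u * hecke_op p q i k \<pi>"
  by (simp add: hecke_op_def algebra_simps)

text \<open>Interchanging the two entries exchanges \<alpha>_i and \<beta>_i, so A_i g changes sign
  under the interchange. The outer A_i therefore multiplies it by -(\<alpha>_i + \<beta>_i), which
  is -1 for distinct entries; for equal entries both sides vanish.\<close>

lemma hecke_op_square:
  assumes "p + q = 1"
  shows "hecke_op p q i (hecke_op p q i g) \<pi> = - hecke_op p q i g \<pi>"
proof -
  have p: "p = 1 - q" using assms by simp
  show ?thesis
    by (cases "\<pi> i" "\<pi> (i + 1)" rule: linorder_cases)
      (simp_all add: p hecke_op_def alpha_def beta_def swap_entries_apply algebra_simps)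
qed

text \<open>Each swap leaves the entries read by the other operator in place, so the coefficients
  pass through and only the commuting swaps remain.\<close>

lemma hecke_op_commute:
  assumes "\<bar>int i - int j\<bar> > 1"
  shows "hecke_op p q i (hecke_op p q j g) \<pi> = hecke_op p q j (hecke_op p q i g) \<pi>"
proof -
  have "alpha p q i (swap_entries j \<pi>) = alpha p q i \<pi>"
    "beta p q i (swap_entries j \<pi>) = beta p q i \<pi>"
    "alpha p q j (swap_entries i \<pi>) = alpha p q j \<pi>"
    "beta p q j (swap_entries i \<pi>) = beta p q j \<pi>"
    using assms by (auto simp: alpha_def beta_def swap_entries_apply)
  then show ?thesis
    using swap_entries_commute[OF assms, of \<pi>] by (simp add: hecke_op_def algebra_simps)
qed

text \<open>Since A_i A_i = -A_i, this is equivalent to the plain braid relation for the shifted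
  operators A_i + p.\<close>

lemma hecke_op_braid:
  assumes "p + q = 1"
  defines "A \<equiv> hecke_op p q"
  shows "A i (A (i + 1) (A i g)) \<pi> - of_real (p * q) * A i g \<pi>
       = A (i + 1) (A i (A (i + 1) g)) \<pi> - of_real (p * q) * A (i + 1) g \<pi>"
proof -
  have p: "p = 1 - q" using assms by simp
  \<comment> \<open>The longest words evaluate \<open>g\<close> at the two triple swaps of
    \<open>\<pi>\<close>; this rule identifies them.\<close>
  note swap_entries_braid[of i \<pi>, simplified, simp]
  show ?thesis
    unfolding A_def
    \<comment> \<open>The relative order of the three entries fixes every coefficient that
      occurs.\<close>
    by (cases "\<pi> i" "\<pi> (i + 1)" rule: linorder_cases;
        cases "\<pi> (i + 1)" "\<pi> (i + 2)" rule: linorder_cases;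
        cases "\<pi> i" "\<pi> (i + 2)" rule: linorder_cases)
      (simp_all add: p hecke_op_def alpha_def beta_def swap_entries_apply algebra_simps)
qed

section \<open>Inversion, commutation and Yang-Baxter equation for 1 + u A_i\<close>

lemma R_op_inverse:
  assumes "p + q = 1" "u + v = u * v"
  shows "R_op p q i v (R_op p q i u g) \<pi> = g \<pi>"
proof -
  \<comment> \<open>A_i A_i = -A_i keeps the product in the span of 1 and A_i.\<close>
  have "R_op p q i v (R_op p q i u g) \<pi> = g \<pi> + (u + v - u * v) * hecke_op p q i g \<pi>"
    by (simp add: R_op_def[of p q i v] hecke_op_R_op hecke_op_square[OF assms(1)])
      (simp add: R_op_def algebra_simps)
  then show ?thesis using assms(2) by simp
qed

lemma R_op_commute:
  assumes "\<bar>int i - int j\<bar> > 1"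
  shows "R_op p q i u (R_op p q j v g) \<pi> = R_op p q j v (R_op p q i u g) \<pi>"
  by (simp add: R_op_def[of p q i u "R_op p q j v g"] R_op_def[of p q j v "R_op p q i u g"]
      hecke_op_R_op hecke_op_commute[OF assms]) (simp add: R_op_def algebra_simps)

text \<open>The products of two different operators agree on both sides. By the braid relation the
  difference of the sides is (a + c - a c + p q a b c - b) (A_i - A_{i+1}) g, and the scalar factor
  is zero by \<open>abc\<close>.\<close>

lemma R_op_yang_baxter:
  assumes pq: "p + q = 1" and abc: "a + c - a * c + of_real (p * q) * a * b * c = b"
  shows "R_op p q i c (R_op p q (i + 1) b (R_op p q i a g)) \<pi>
       = R_op p q (i + 1) a (R_op p q i b (R_op p q (i + 1) c g)) \<pi>"
proof -
  define A where "A = hecke_op p q"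
  have R: "R_op p q j u f = (\<lambda>\<pi>. f \<pi> + u * A j f \<pi>)" for j u f
    by (simp add: fun_eq_iff R_op_def A_def)
  have lin: "A j (\<lambda>\<pi>. f \<pi> + u * k \<pi>) = (\<lambda>\<pi>. A j f \<pi> + u * A j k \<pi>)" for j u f k
    by (simp add: fun_eq_iff A_def hecke_op_linear)
  have sq: "A j (A j f) = (\<lambda>\<pi>. - A j f \<pi>)" for j f
    by (simp add: fun_eq_iff A_def hecke_op_square[OF pq])
  \<comment> \<open>One expansion serves both sides: \<open>j\<close> and \<open>k\<close> trade
    places, and so do the outer parameters \<open>u\<close> and \<open>w\<close>.\<close>
  have expand: "R_op p q j w (R_op p q k v (R_op p q j u g)) \<pi>
      = g \<pi> + (u + w - u * w) * A j g \<pi> + v * A k g \<pi> + u * v * A k (A j g) \<pi>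
        + v * w * A j (A k g) \<pi> + u * v * w * A j (A k (A j g)) \<pi>" for j k u v w
    by (simp only: R lin sq) (simp add: algebra_simps)
  let ?r = "of_real (p * q) :: complex"
  have braid: "A i (A (i + 1) (A i g)) \<pi>
      = A (i + 1) (A i (A (i + 1) g)) \<pi> + ?r * A i g \<pi> - ?r * A (i + 1) g \<pi>"
    using hecke_op_braid[OF pq, of i g \<pi>] unfolding A_def by (simp add: algebra_simps)
  have ac: "a + c - a * c = b - ?r * a * b * c" "c + a - c * a = b - ?r * a * b * c"
    using abc by (simp_all add: algebra_simps)
  show ?thesis
    unfolding expand ac braid by (simp add: algebra_simps)
qed

section \<open>Scalar identities for 1 + S\<close>

lemma S_eq: "S p q x y = - (S_denom p q y x / S_denom p q x y)"
  by (simp add: S_def S_denom_def algebra_simps)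

lemma one_plus_S:
  assumes "S_denom p q x y \<noteq> 0"
  shows "1 + S p q x y = (x - y) / S_denom p q x y"
  using assms by (simp add: S_def S_denom_def field_simps)

text \<open>Because S(x,y) S(y,x) = 1, both sides equal 2 + S(x,y) + S(y,x).\<close>

lemma one_plus_S_inverse:
  assumes "S_denom p q x y \<noteq> 0" "S_denom p q y x \<noteq> 0"
  shows "(1 + S p q x y) + (1 + S p q y x) = (1 + S p q x y) * (1 + S p q y x)"
proof -
  have "S p q x y * S p q y x = 1"
    using assms by (simp add: S_eq)
  then show ?thesis by (simp add: algebra_simps)
qed

lemma one_plus_S_yang_baxter:
  assumes pq: "p + q = 1"
    and nz: "S_denom p q x y \<noteq> 0" "S_denom p q x z \<noteq> 0" "S_denom p q y z \<noteq> 0"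
  defines "a \<equiv> 1 + S p q x y" and "b \<equiv> 1 + S p q x z" and "c \<equiv> 1 + S p q y z"
  shows "a + c - a * c + of_real (p * q) * a * b * c = b"
proof -
  define d e f where "d = S_denom p q x y" and "e = S_denom p q x z" and "f = S_denom p q y z"
  have p: "complex_of_real p = 1 - of_real q"
    using pq by (metis add_diff_cancel_right' of_real_1 of_real_diff)
  \<comment> \<open>This is the claim multiplied by \<open>d * e * f\<close>. With p replaced by 1 -
    q it is a polynomial identity in x, y, z and q.\<close>
  have "(x - y) * e * f + (y - z) * d * e - (x - y) * (y - z) * e
      + of_real (p * q) * (x - y) * (x - z) * (y - z) = (x - z) * d * f"
    unfolding d_def e_def f_def S_denom_def of_real_mult p by algebra
  moreover have "x - y = a * d" "x - z = b * e" "y - z = c * f"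
    using nz by (simp_all add: a_def b_def c_def d_def e_def f_def one_plus_S)
  ultimately have "(a + c - a * c + of_real (p * q) * a * b * c) * (d * e * f) = b * (d * e * f)"
    by (simp only:) (simp add: algebra_simps)
  then show ?thesis
    using nz by (simp add: d_def e_def f_def)
qed

section \<open>From operators at a fixed \<xi> to the maps on \<open>H\<close>\<close>

lemma T_in_H:
  assumes "i \<in> {1..N-1}" "x \<in> H p q N M"
  shows "T p q N M i x \<in> H p q N M"
  using assms swap_entries_permutes[OF assms(1)]
  by (auto simp: H_def H0_def T_def T0_def split: prod.splits)

lemma fst_T [simp]: "fst (T p q N M i x) = swap_entries i (fst x)"
  by (simp add: T_def split: prod.splits)

text \<open>Agreement with \<open>g\<close> is required only on \<open>configs\<close>, which swaps
  preserve. The conclusion thus has the shape of the last premise, and the lemma can be nested for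
  iterated maps.\<close>

lemma snd_T:
  assumes "i \<in> {1..N-1}" "\<xi> \<in> xi_domain p q N" "\<pi> \<in> configs N M"
    and "\<And>\<rho>. \<rho> \<in> configs N M \<Longrightarrow> snd x \<rho> \<xi> = g \<rho>"
  shows "snd (T p q N M i x) \<pi> \<xi>
    = R_op p q i (1 + S p q (\<xi> (fst x i)) (\<xi> (fst x (i + 1)))) g \<pi>"
  using assms swap_entries_configs[OF assms(1,3)]
  by (cases x) (simp add: T_def T0_def R_op_def hecke_op_def)

lemma H_eqI:
  assumes "x \<in> H p q N M" "y \<in> H p q N M" "fst x = fst y"
    and "\<And>\<pi> \<xi>. \<pi> \<in> configs N M \<Longrightarrow> \<xi> \<in> xi_domain p q N \<Longrightarrow> snd x \<pi> \<xi> = snd y \<pi> \<xi>"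
  shows "x = y"
proof (rule prod_eqI)
  have H0: "snd x \<in> H0 p q N M" "snd y \<in> H0 p q N M"
    using assms(1,2) by (auto simp: H_def)
  show "snd x = snd y"
  proof (rule PiE_ext[OF H0[unfolded H0_def]])
    fix \<pi> assume \<pi>: "\<pi> \<in> configs N M"
    have "snd x \<pi> \<in> xi_domain p q N \<rightarrow>\<^sub>E UNIV" "snd y \<pi> \<in> xi_domain p q N \<rightarrow>\<^sub>E UNIV"
      using H0 \<pi> by (auto simp: H0_def)
    then show "snd x \<pi> = snd y \<pi>"
      by (rule PiE_ext) (rule assms(4)[OF \<pi>])
  qed
qed (fact assms(3))

text \<open>A permutation sends distinct positions to distinct indices, and \<open>xi_domain\<close>
  excludes the zeros for those.\<close>

lemma S_denom_nonzero:
  assumes "x \<in> H p q N M" "\<xi> \<in> xi_domain p q N" "i \<in> {1..N}" "j \<in> {1..N}" "i \<noteq> j"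
  shows "S_denom p q (\<xi> (fst x i)) (\<xi> (fst x j)) \<noteq> 0"
proof -
  have \<sigma>: "fst x permutes {1..N}" using assms(1) by (auto simp: H_def)
  have "fst x i \<in> {1..N}" "fst x j \<in> {1..N}" "fst x i \<noteq> fst x j"
    using permutes_in_image[OF \<sigma>] permutes_inj[OF \<sigma>] assms(3-5) by (auto dest: injD)
  then show ?thesis using assms(2) by (auto simp: xi_domain_def)
qed

lemma T_involution:
  assumes pq: "p + q = 1" and i: "i \<in> {1..N-1}" and x: "x \<in> H p q N M"
  shows "T p q N M i (T p q N M i x) = x"
proof (rule H_eqI[OF T_in_H[OF i T_in_H[OF i x]] x])
  fix \<pi> \<xi> assume \<pi>: "\<pi> \<in> configs N M" and \<xi>: "\<xi> \<in> xi_domain p q N"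
  let ?u = "1 + S p q (\<xi> (fst x i)) (\<xi> (fst x (i + 1)))"
  \<comment> \<open>The first application has interchanged the entries of the permutation, so the
    second factor has its arguments reversed.\<close>
  let ?v = "1 + S p q (\<xi> (fst x (i + 1))) (\<xi> (fst x i))"
  have "snd (T p q N M i (T p q N M i x)) \<pi> \<xi>
      = R_op p q i ?v (R_op p q i ?u (\<lambda>\<pi>. snd x \<pi> \<xi>)) \<pi>"
    by (subst snd_T[OF i \<xi> \<pi> snd_T[OF i \<xi> _ refl]]) (simp_all add: swap_entries_apply)
  also have "\<dots> = snd x \<pi> \<xi>"
    using i by (intro R_op_inverse pq one_plus_S_inverse S_denom_nonzero[OF x \<xi>]) auto
  finally show "snd (T p q N M i (T p q N M i x)) \<pi> \<xi> = snd x \<pi> \<xi>" .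
qed simp

lemma T_commute:
  assumes i: "i \<in> {1..N-1}" and j: "j \<in> {1..N-1}" and ij: "\<bar>int i - int j\<bar> > 1"
    and x: "x \<in> H p q N M"
  shows "T p q N M i (T p q N M j x) = T p q N M j (T p q N M i x)"
proof (rule H_eqI[OF T_in_H[OF i T_in_H[OF j x]] T_in_H[OF j T_in_H[OF i x]]])
  fix \<pi> \<xi> assume \<pi>: "\<pi> \<in> configs N M" and \<xi>: "\<xi> \<in> xi_domain p q N"
  let ?g = "\<lambda>\<pi>. snd x \<pi> \<xi>"
  let ?u = "1 + S p q (\<xi> (fst x i)) (\<xi> (fst x (i + 1)))"
  let ?v = "1 + S p q (\<xi> (fst x j)) (\<xi> (fst x (j + 1)))"
  \<comment> \<open>Neither map moves the permutation entries that the other reads, so both orders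
    use the same \<open>?u\<close> and \<open>?v\<close>.\<close>
  have sw: "fst (T p q N M j x) i = fst x i" "fst (T p q N M j x) (i + 1) = fst x (i + 1)"
    "fst (T p q N M i x) j = fst x j" "fst (T p q N M i x) (j + 1) = fst x (j + 1)"
    using ij by (auto simp: swap_entries_apply)
  have "snd (T p q N M i (T p q N M j x)) \<pi> \<xi> = R_op p q i ?u (R_op p q j ?v ?g) \<pi>"
    by (subst snd_T[OF i \<xi> \<pi> snd_T[OF j \<xi> _ refl]]) (simp_all only: sw)
  also have "\<dots> = R_op p q j ?v (R_op p q i ?u ?g) \<pi>"
    by (rule R_op_commute[OF ij])
  also have "\<dots> = snd (T p q N M j (T p q N M i x)) \<pi> \<xi>"
    by (subst snd_T[OF j \<xi> \<pi> snd_T[OF i \<xi> _ refl]]) (simp_all only: sw)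
  finally show "snd (T p q N M i (T p q N M j x)) \<pi> \<xi> = snd (T p q N M j (T p q N M i x)) \<pi> \<xi>" .
qed (simp add: swap_entries_commute[OF ij])

lemma T_braid:
  assumes pq: "p + q = 1" and i: "i \<in> {1..N-1}" and i': "i + 1 \<in> {1..N-1}"
    and x: "x \<in> H p q N M"
  shows "T p q N M i (T p q N M (i + 1) (T p q N M i x))
       = T p q N M (i + 1) (T p q N M i (T p q N M (i + 1) x))" (is "?L = ?R")
proof (rule H_eqI)
  show "?L \<in> H p q N M" "?R \<in> H p q N M"
    by (intro T_in_H i i' x)+
  show "fst ?L = fst ?R"
    using swap_entries_braid[of i "fst x"] by simp
next
  fix \<pi> \<xi> assume \<pi>: "\<pi> \<in> configs N M" and \<xi>: "\<xi> \<in> xi_domain p q N"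
  let ?g = "\<lambda>\<pi>. snd x \<pi> \<xi>"
  \<comment> \<open>As the permutation changes, the left side meets the pairs of entries at
    positions (i, i+1), (i, i+2), (i+1, i+2) of the original one in this order; the right side meets
    them in reverse.\<close>
  let ?a = "1 + S p q (\<xi> (fst x i)) (\<xi> (fst x (i + 1)))"
  let ?b = "1 + S p q (\<xi> (fst x i)) (\<xi> (fst x (i + 2)))"
  let ?c = "1 + S p q (\<xi> (fst x (i + 1))) (\<xi> (fst x (i + 2)))"
  have "snd ?L \<pi> \<xi> = R_op p q i ?c (R_op p q (i + 1) ?b (R_op p q i ?a ?g)) \<pi>"
    by (subst snd_T[OF i \<xi> \<pi> snd_T[OF i' \<xi> _ snd_T[OF i \<xi> _ refl]]])
      (simp_all add: swap_entries_apply)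
  also have "\<dots> = R_op p q (i + 1) ?a (R_op p q i ?b (R_op p q (i + 1) ?c ?g)) \<pi>"
    using i i'
    by (intro R_op_yang_baxter pq one_plus_S_yang_baxter S_denom_nonzero[OF x \<xi>]) auto
  also have "\<dots> = snd ?R \<pi> \<xi>"
    by (subst snd_T[OF i' \<xi> \<pi> snd_T[OF i \<xi> _ snd_T[OF i' \<xi> _ refl]]])
      (simp_all add: swap_entries_apply)
  finally show "snd ?L \<pi> \<xi> = snd ?R \<pi> \<xi>" .
qed

theorem mainTheorem2:
  fixes p q :: real and N M :: nat
  assumes "N \<ge> 1" and "M \<ge> 1"
    and "p \<ge> 0" and "q \<ge> 0" and "p + q = 1"
  shows "(\<forall>i\<in>{1..N-1}. T p q N M i \<in> H p q N M \<rightarrow> H p q N M)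
    \<and> (\<forall>i\<in>{1..N-1}. \<forall>x\<in>H p q N M. T p q N M i (T p q N M i x) = x)
    \<and> (\<forall>i\<in>{1..N-1}. \<forall>j\<in>{1..N-1}. \<bar>int i - int j\<bar> > 1 \<longrightarrow>
         (\<forall>x\<in>H p q N M. T p q N M i (T p q N M j x) = T p q N M j (T p q N M i x)))
    \<and> (\<forall>i. i \<in> {1..N-1} \<and> i + 1 \<in> {1..N-1} \<longrightarrow>
         (\<forall>x\<in>H p q N M. T p q N M i (T p q N M (i + 1) (T p q N M i x))
            = T p q N M (i + 1) (T p q N M i (T p q N M (i + 1) x))))"
  by (intro conjI allI ballI impI funcsetI; (elim conjE)?)
    (rule T_in_H T_involution[OF assms(5)] T_commute T_braid[OF assms(5)]; assumption)+

end
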